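(* Let $m\ge1$ and $p\ge2$. For $s\ge2$ and $\sigma\ge\lambda_m$ put $$\tilde f_s(\sigma) = \frac{1}{m} \sum_{i=1}^m (\sigma - \lambda_i)^s - \frac{s\beta}{\gamma N}\, \frac{1}{m} \sum_{i=1}^m (\sigma - \lambda_i)^{s-1}\lambda_i ,$$ $$\tilde\sigma_s=\sup\{t\ge\lambda_m : \tilde f_s(\sigma)\le0\text{ for all }\lambda_m\le\sigma\le t\}.$$ Then $\tilde f_p(\sigma)\le0$ for all $\sigma\in[\lambda_m,\tilde\sigma_2]$, and hence, since $\lambda_{m+1}\le\tilde\sigma_2$, one has $\lambda_{m+1}\le\tilde\sigma_p$. Moreover $\tilde\sigma_p\ge\tilde\sigma_2$, where $\tilde\sigma_2=\sigma_2$ with $$\sigma_2=\Big(1+\frac{\beta}{\gamma N}\Big)S_1+\left\{\Big(1+\frac{\beta}{\gamma N}\Big)^2S_1^2-\Big(1+\frac{2\beta}{\gamma N}\Big)S_2\right\}^{1/2},\qquad S_\ell=\frac1m\sum_{i=1}^m\lambda_i^\ell .$$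
   Context: $\mathcal{H}$ is a complex Hilbert space with inner product $\langle\cdot,\cdot\rangle$ and norm $\|u\|=\sqrt{\langle u,u\rangle}$. $A:\mathcal{D}\subset\mathcal{H}\to\mathcal{H}$ is a self-adjoint operator defined on a dense domain $\mathcal{D}$, semibounded below, with discrete spectrum $\lambda_1\le\lambda_2\le\lambda_3\le\cdots$ (eigenvalues listed with multiplicity). $\{u_i\}_{i=1}^\infty$ are normalized eigenvectors, $Au_i=\lambda_iu_i$, forming an orthonormal basis of $\mathcal{H}$. $B_1,\dots,B_N$ are symmetric operators, defined on $\mathcal{D}$ and on $A(\mathcal{D})$ with values in $\mathcal{H}$, which leave $\mathcal{D}$ invariant. The commutator is $[A,B]=AB-BA$. It is assumed that there are constants $\beta,\gamma>0$ with $$\gamma\le[B_k,[A,B_k]]\quad(1\le k\le N),\qquad -\sum_{k=1}^N[A,B_k]^2\le\beta A .$$ Here, for a symmetric operator $C$ and $\alpha\in\mathbb{R}$, $C\ge\alpha$ means $\langle Cu,u\rangle\ge\alpha\langle u,u\rangle$ for all $u\in\mathcal{D}(C)$; for symmetric operators $C,D$, $C\ge D$ means $\mathcal{D}(D)\subset\mathcal{D}(C)$ and $C-D\ge0$ on $\mathcal{D}(D)$. The eigenvectors $u_i$ are understood to belong to the domains of the operators in these two inequalities. *)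

theory Defs
  imports "HOL-Analysis.Analysis"
begin

subsection \<open>Complex Hilbert spaces\<close>

text \<open>Norm, metric and topology are those of the underlying real inner product space, whose
  inner product is the real part of the complex one; so norm x is the square root of
  cinner x x. The complex inner product is linear in its first argument.\<close>

class complex_inner = real_inner +
  fixes scaleC :: "complex \<Rightarrow> 'a \<Rightarrow> 'a"  (infixr "*\<^sub>C" 75)
    and cinner :: "'a \<Rightarrow> 'a \<Rightarrow> complex"
  assumes scaleC_add_right: "c *\<^sub>C (x + y) = c *\<^sub>C x + c *\<^sub>C y"
    and scaleC_add_left: "(c + d) *\<^sub>C x = c *\<^sub>C x + d *\<^sub>C x"
    and scaleC_scaleC: "c *\<^sub>C d *\<^sub>C x = (c * d) *\<^sub>C x"
    and scaleR_eq_scaleC: "r *\<^sub>R x = complex_of_real r *\<^sub>C x"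
    and cinner_commute: "cinner x y = cnj (cinner y x)"
    and cinner_add_left: "cinner (x + y) z = cinner x z + cinner y z"
    and cinner_scaleC_left: "cinner (c *\<^sub>C x) y = c * cinner x y"
    and inner_eq_Re_cinner: "inner x y = Re (cinner x y)"

class chilbert_space = complex_inner + complete_space

global_interpretation complex_vector:
  vector_space "scaleC :: complex \<Rightarrow> 'a \<Rightarrow> 'a::complex_inner"
  defines csubspace = complex_vector.subspace
    and cspan = complex_vector.span
proof
  fix x :: 'a
  show "1 *\<^sub>C x = x"
    using scaleR_eq_scaleC[of 1 x] by simp
qed (simp_all add: scaleC_add_right scaleC_add_left scaleC_scaleC)

definition orthonormal_basis :: "'i set \<Rightarrow> ('i \<Rightarrow> 'a::chilbert_space) \<Rightarrow> bool" where
  "orthonormal_basis I u \<longleftrightarrow>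
     (\<forall>i\<in>I. \<forall>j\<in>I. cinner (u i) (u j) = (if i = j then 1 else 0)) \<and>
     closure (cspan (u ` I)) = UNIV"


subsection \<open>Partially defined operators\<close>

text \<open>Only the values of app on dom are meaningful: every notion below looks at app
  on the relevant domains only.\<close>

record 'a operator =
  odom :: "'a set"
  app :: "'a \<Rightarrow> 'a"

definition linear_operator :: "'a::complex_inner operator \<Rightarrow> bool" where
  "linear_operator T \<longleftrightarrow> csubspace (odom T) \<and>
     (\<forall>x\<in>odom T. \<forall>y\<in>odom T. app T (x + y) = app T x + app T y) \<and>
     (\<forall>c. \<forall>x\<in>odom T. app T (c *\<^sub>C x) = c *\<^sub>C app T x)"

definition symmetric_operator :: "'a::complex_inner operator \<Rightarrow> bool" where
  "symmetric_operator T \<longleftrightarrow> linear_operator T \<and>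
     (\<forall>x\<in>odom T. \<forall>y\<in>odom T. cinner (app T x) y = cinner x (app T y))"

definition densely_defined :: "'a::complex_inner operator \<Rightarrow> bool" where
  "densely_defined T \<longleftrightarrow> closure (odom T) = UNIV"

definition adjoint_operator :: "'a::complex_inner operator \<Rightarrow> 'a operator" where
  "adjoint_operator T =
     \<lparr> odom = {y. \<exists>z. \<forall>x\<in>odom T. cinner (app T x) y = cinner x z},
       app = (\<lambda>y. THE z. \<forall>x\<in>odom T. cinner (app T x) y = cinner x z) \<rparr>"

definition selfadjoint_operator :: "'a::complex_inner operator \<Rightarrow> bool" where
  "selfadjoint_operator T \<longleftrightarrow> linear_operator T \<and> densely_defined T \<and>
     odom (adjoint_operator T) = odom T \<and>
     (\<forall>x\<in>odom T. app (adjoint_operator T) x = app T x)"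

text \<open>Algebraic operations, always on the maximal natural domain.\<close>

definition op_comp :: "'a operator \<Rightarrow> 'a operator \<Rightarrow> 'a operator" where
  "op_comp S T =
     \<lparr> odom = {x \<in> odom T. app T x \<in> odom S}, app = (\<lambda>x. app S (app T x)) \<rparr>"

definition op_diff :: "'a::complex_inner operator \<Rightarrow> 'a operator \<Rightarrow> 'a operator" where
  "op_diff S T = \<lparr> odom = odom S \<inter> odom T, app = (\<lambda>x. app S x - app T x) \<rparr>"

definition op_scale :: "real \<Rightarrow> 'a::complex_inner operator \<Rightarrow> 'a operator" where
  "op_scale r T = \<lparr> odom = odom T, app = (\<lambda>x. r *\<^sub>R app T x) \<rparr>"

definition op_sum :: "('i \<Rightarrow> 'a::complex_inner operator) \<Rightarrow> 'i set \<Rightarrow> 'a operator" where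
  "op_sum T I = \<lparr> odom = (\<Inter>i\<in>I. odom (T i)), app = (\<lambda>x. \<Sum>i\<in>I. app (T i) x) \<rparr>"

definition commutator :: "'a::complex_inner operator \<Rightarrow> 'a operator \<Rightarrow> 'a operator" where
  "commutator S T = op_diff (op_comp S T) (op_comp T S)"

text \<open>Order relations between symmetric operators. For symmetric C the number
  cinner (app C x) x is real, so taking real parts loses nothing.\<close>

definition op_bounded_below_by :: "real \<Rightarrow> 'a::complex_inner operator \<Rightarrow> bool" where
  "op_bounded_below_by \<alpha> C \<longleftrightarrow>
     (\<forall>x\<in>odom C. \<alpha> * Re (cinner x x) \<le> Re (cinner (app C x) x))"

definition op_le :: "'a::complex_inner operator \<Rightarrow> 'a operator \<Rightarrow> bool" where
  "op_le D C \<longleftrightarrow> odom D \<subseteq> odom C \<and>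
     (\<forall>x\<in>odom D. 0 \<le> Re (cinner (app (op_diff C D) x) x))"

definition semibounded_below :: "'a::complex_inner operator \<Rightarrow> bool" where
  "semibounded_below T \<longleftrightarrow> (\<exists>c. op_bounded_below_by c T)"


subsection \<open>Spectrum\<close>

definition resolvent_set :: "'a::complex_inner operator \<Rightarrow> complex set" where
  "resolvent_set T = {z. \<exists>R. bounded_linear R \<and>
     (\<forall>y. R y \<in> odom T \<and> app T (R y) - z *\<^sub>C R y = y) \<and>
     (\<forall>x\<in>odom T. R (app T x - z *\<^sub>C x) = x)}"

definition spectrum :: "'a::complex_inner operator \<Rightarrow> complex set" where
  "spectrum T = - resolvent_set T"

definition eigenspace :: "'a::complex_inner operator \<Rightarrow> complex \<Rightarrow> 'a set" where
  "eigenspace T z = {x \<in> odom T. app T x = z *\<^sub>C x}"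

text \<open>The whole spectrum consists of isolated eigenvalues of finite multiplicity.\<close>

definition has_discrete_spectrum :: "'a::complex_inner operator \<Rightarrow> bool" where
  "has_discrete_spectrum T \<longleftrightarrow>
     (\<forall>z\<in>spectrum T. z isolated_in spectrum T \<and> eigenspace T z \<noteq> {0} \<and>
        (\<exists>E. finite E \<and> eigenspace T z \<subseteq> cspan E))"


subsection \<open>The functions and thresholds built from the eigenvalues\<close>

text \<open>The functions are only used for real s at least 2 and sigma at least lam m, where
  all bases of powr are nonnegative and all exponents positive; there
  0 powr a = 0 is the usual power.\<close>

definition f_tilde ::
    "(nat \<Rightarrow> real) \<Rightarrow> nat \<Rightarrow> nat \<Rightarrow> real \<Rightarrow> real \<Rightarrow> real \<Rightarrow> real \<Rightarrow> real" where
  "f_tilde lam m N \<beta> \<gamma> s \<sigma> =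
     1 / real m * (\<Sum>i=1..m. (\<sigma> - lam i) powr s)
     - s * \<beta> / (\<gamma> * real N) * (1 / real m) * (\<Sum>i=1..m. (\<sigma> - lam i) powr (s - 1) * lam i)"

text \<open>The supremum is taken in the extended reals, so that it needs no side conditions
  (nonempty, bounded above).\<close>

definition sigma_tilde ::
    "(nat \<Rightarrow> real) \<Rightarrow> nat \<Rightarrow> nat \<Rightarrow> real \<Rightarrow> real \<Rightarrow> real \<Rightarrow> ereal" where
  "sigma_tilde lam m N \<beta> \<gamma> s =
     (SUP t \<in> {t. lam m \<le> t \<and> (\<forall>\<sigma>. lam m \<le> \<sigma> \<and> \<sigma> \<le> t \<longrightarrow> f_tilde lam m N \<beta> \<gamma> s \<sigma> \<le> 0)}.
        ereal t)"

definition S_mean :: "(nat \<Rightarrow> real) \<Rightarrow> nat \<Rightarrow> nat \<Rightarrow> real" where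
  "S_mean lam m l = 1 / real m * (\<Sum>i=1..m. lam i ^ l)"

definition sigma_two :: "(nat \<Rightarrow> real) \<Rightarrow> nat \<Rightarrow> nat \<Rightarrow> real \<Rightarrow> real \<Rightarrow> real" where
  "sigma_two lam m N \<beta> \<gamma> =
     (1 + \<beta> / (\<gamma> * real N)) * S_mean lam m 1
     + sqrt ((1 + \<beta> / (\<gamma> * real N))\<^sup>2 * (S_mean lam m 1)\<^sup>2
             - (1 + 2 * \<beta> / (\<gamma> * real N)) * S_mean lam m 2)"

end

theory Submission
  imports Defs
begin

text \<open>Expanding the double commutator and the squared commutator at an eigenvector in the
  eigenbasis gives, with w = |<B u_i, u_j>|^2, the weighted sums of lam j - lam i and of
  (lam j - lam i)^2. As w is symmetric in i and j, antisymmetrisation yields Yang's inequality,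
  that is, f_2 <= 0 on [lam m, lam (m + 1)] for every m. For fixed m, applying this for all j <= m
  shows that the sum of (y - lam i)_+^2 - 2 c (y - lam i)_+ lam i over i <= m, where
  c = beta / (gamma N), is nonpositive for all y up to the larger root sigma_2 of the quadratic
  f_2. Integrating it against t^(p - 3) at y = sigma - t turns (y - lam i)_+^2 into a power p and
  gives f_p(sigma) <= 0. Knowing f_2 <= 0 only on [lam m, sigma] would not suffice.\<close>

section \<open>Complex inner products\<close>

lemma cinner_add_right: "cinner x (y + z) = cinner x y + cinner x (z::'a::complex_inner)"
  by (metis cinner_add_left cinner_commute complex_cnj_add)

lemma cinner_scaleC_right: "cinner x (c *\<^sub>C y) = cnj c * cinner x (y::'a::complex_inner)"
  by (metis cinner_scaleC_left cinner_commute complex_cnj_mult)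

lemma cinner_scaleR_left: "cinner (r *\<^sub>R x) y = of_real r * cinner x (y::'a::complex_inner)"
  by (simp add: scaleR_eq_scaleC cinner_scaleC_left)

lemma cinner_scaleR_right: "cinner x (r *\<^sub>R y) = of_real r * cinner x (y::'a::complex_inner)"
  by (simp add: scaleR_eq_scaleC cinner_scaleC_right)

lemma cinner_zero_left [simp]: "cinner 0 (y::'a::complex_inner) = 0"
  using cinner_scaleR_left[of 0 0 y] by simp

lemma cinner_diff_left: "cinner (x - y) z = cinner x z - cinner y (z::'a::complex_inner)"
  using cinner_add_left[of "x - y" y z] by simp

lemma cinner_diff_right: "cinner x (y - z) = cinner x y - cinner x (z::'a::complex_inner)"
  using cinner_add_right[of x "y - z" z] by simp

lemma cinner_sum_left:
  "cinner (\<Sum>i\<in>I. f i) (y::'a::complex_inner) = (\<Sum>i\<in>I. cinner (f i) y)"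
  by (induction I rule: infinite_finite_induct) (simp_all add: cinner_add_left)

section \<open>Partial Fourier sums and Parseval's identity\<close>

definition projection_upto :: "(nat \<Rightarrow> 'a::complex_inner) \<Rightarrow> nat \<Rightarrow> 'a \<Rightarrow> 'a" where
  "projection_upto u n x = (\<Sum>j=1..n. cinner x (u j) *\<^sub>C u j)"

lemma projection_upto_add:
  "projection_upto u n (x + y) = projection_upto u n x + projection_upto u n y"
  by (simp add: projection_upto_def cinner_add_left scaleC_add_left sum.distrib)

lemma projection_upto_scaleC:
  "projection_upto u n (c *\<^sub>C x) = c *\<^sub>C projection_upto u n x"
  by (simp add: projection_upto_def cinner_scaleC_left complex_vector.scale_sum_right
      scaleC_scaleC)

lemma projection_upto_diff:
  "projection_upto u n (x - y) = projection_upto u n x - projection_upto u n y"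
  using projection_upto_add[of u n "x - y" y] by (simp add: algebra_simps)

lemma inner_projection_upto:
  "inner (projection_upto u n x) y
     = (\<Sum>j=1..n. Re (cinner x (u j) * cnj (cinner y (u j))))"
  unfolding inner_eq_Re_cinner projection_upto_def cinner_sum_left cinner_scaleC_left
  by (simp add: cinner_commute[of y])

lemma projection_upto_basis:
  assumes "\<forall>i\<in>{1..}. \<forall>j\<in>{1..}. cinner (u i) (u j) = (if i = j then 1 else 0)"
    and "1 \<le> j" "j \<le> n"
  shows "projection_upto u n (u j) = u j"
proof -
  have "projection_upto u n (u j) = (\<Sum>i=1..n. if i = j then u j else 0)"
    unfolding projection_upto_def using assms
    by (intro sum.cong) auto
  also have "\<dots> = u j"
    using assms by simp
  finally show ?thesis .
qed

lemma cinner_projection_upto: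
  assumes "\<forall>i\<in>{1..}. \<forall>j\<in>{1..}. cinner (u i) (u j) = (if i = j then 1 else 0)"
    and "1 \<le> j" "j \<le> n"
  shows "cinner (projection_upto u n x) (u j) = cinner x (u j)"
proof -
  have "cinner (projection_upto u n x) (u j)
      = (\<Sum>i=1..n. if i = j then cinner x (u j) else 0)"
    unfolding projection_upto_def cinner_sum_left cinner_scaleC_left using assms
    by (intro sum.cong) auto
  also have "\<dots> = cinner x (u j)"
    using assms by simp
  finally show ?thesis .
qed

text \<open>Pythagoras: by orthonormality the inner product of the projection with itself equals
  that with \<open>x\<close>.\<close>

lemma norm_projection_upto_residual_le:
  assumes "\<forall>i\<in>{1..}. \<forall>j\<in>{1..}. cinner (u i) (u j) = (if i = j then 1 else 0)"
  shows "norm (x - projection_upto u n x) \<le> norm x"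
proof -
  let ?p = "projection_upto u n x"
  have "inner ?p ?p = inner ?p x"
    unfolding inner_projection_upto
    by (intro sum.cong) (simp_all add: cinner_projection_upto[OF assms])
  then have "(norm (x - ?p))\<^sup>2 = (norm x)\<^sup>2 - (norm ?p)\<^sup>2"
    by (simp add: power2_norm_eq_inner inner_diff_left inner_diff_right inner_commute)
  then have "(norm (x - ?p))\<^sup>2 \<le> (norm x)\<^sup>2"
    by simp
  then show ?thesis
    by (rule power2_le_imp_le) simp
qed

text \<open>A basis is given only through density of its span. A vector of the span is fixed by all
  late projections, and since the residual never exceeds the norm, approximation by such vectors
  carries convergence over to every \<open>x\<close>.\<close>

lemma projection_upto_tendsto:
  fixes u :: "nat \<Rightarrow> 'a::chilbert_space"
  assumes "orthonormal_basis {1..} u"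
  shows "(\<lambda>n. projection_upto u n x) \<longlonglongrightarrow> x"
proof -
  have on: "\<forall>i\<in>{1..}. \<forall>j\<in>{1..}. cinner (u i) (u j) = (if i = j then 1 else 0)"
    and dense: "closure (cspan (u ` {1..})) = UNIV"
    using assms unfolding orthonormal_basis_def by blast+
  have stable: "\<exists>n0. \<forall>n\<ge>n0. projection_upto u n s = s" if "s \<in> cspan (u ` {1..})" for s
    using that
  proof (induction rule: complex_vector.span_induct_alt)
    case base
    show ?case by (simp add: projection_upto_def)
  next
    case (step c b y)
    then obtain j n0 where "b = u j" "1 \<le> j" "\<forall>n\<ge>n0. projection_upto u n y = y"
      by auto
    then have "\<forall>n\<ge>max j n0. projection_upto u n (c *\<^sub>C b + y) = c *\<^sub>C b + y"
      by (simp add: projection_upto_add projection_upto_scaleC projection_upto_basis[OF on])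
    then show ?case by blast
  qed
  show ?thesis
  proof (rule LIMSEQ_I)
    fix e :: real assume "0 < e"
    have "x \<in> closure (cspan (u ` {1..}))"
      using dense by simp
    then obtain s where s: "s \<in> cspan (u ` {1..})" "dist s x < e"
      using \<open>0 < e\<close> unfolding closure_approachable by blast
    then obtain n0 where n0: "\<forall>n\<ge>n0. projection_upto u n s = s"
      using stable by blast
    have "norm (projection_upto u n x - x) < e" if "n \<ge> n0" for n
    proof -
      have "norm (projection_upto u n x - x) = norm ((x - s) - projection_upto u n (x - s))"
        using n0 that by (simp add: projection_upto_diff norm_minus_commute)
      also have "\<dots> \<le> norm (x - s)"
        by (rule norm_projection_upto_residual_le[OF on])
      finally show ?thesis
        using s(2) by (simp add: dist_norm norm_minus_commute)
    qed
    then show "\<exists>n0. \<forall>n\<ge>n0. norm (projection_upto u n x - x) < e"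
      by blast
  qed
qed

text \<open>Stated through partial sums, so that later manipulations concern finite sums only and no
  summability has to be tracked.\<close>

lemma parseval_tendsto:
  fixes u :: "nat \<Rightarrow> 'a::chilbert_space"
  assumes "orthonormal_basis {1..} u"
  shows "(\<lambda>n. \<Sum>j=1..n. Re (cinner x (u j) * cnj (cinner y (u j)))) \<longlonglongrightarrow> inner x y"
  using tendsto_inner[OF projection_upto_tendsto[OF assms] tendsto_const]
  unfolding inner_projection_upto .


section \<open>Commutators at an eigenvector\<close>

lemma dense_inner_zero_imp_zero:
  fixes d :: "'a::real_inner"
  assumes "closure S = UNIV" and "\<And>x. x \<in> S \<Longrightarrow> inner x d = 0"
  shows "d = 0"
proof -
  have "closed {x. inner x d = 0}"
    by (intro closed_Collect_eq continuous_intros)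
  then have "closure S \<subseteq> {x. inner x d = 0}"
    using assms(2) by (intro closure_minimal) auto
  then have "d \<in> {x. inner x d = 0}"
    using assms(1) by blast
  then show ?thesis by simp
qed

text \<open>The value of the adjoint is a definite description; density of the domain makes the
  representing vector unique, so the description can be evaluated.\<close>

lemma selfadjoint_imp_symmetric_operator:
  assumes "selfadjoint_operator T"
  shows "symmetric_operator T"
proof -
  have lin: "linear_operator T" and dense: "closure (odom T) = UNIV"
    and dom: "odom (adjoint_operator T) = odom T"
    and app: "\<And>x. x \<in> odom T \<Longrightarrow> app (adjoint_operator T) x = app T x"
    using assms unfolding selfadjoint_operator_def densely_defined_def by auto
  have "cinner (app T x) y = cinner x (app T y)" if x: "x \<in> odom T" and y: "y \<in> odom T" for x y
  proof -
    have "\<exists>z. \<forall>x\<in>odom T. cinner (app T x) y = cinner x z"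
      using y dom unfolding adjoint_operator_def by auto
    then obtain z where z: "\<forall>x\<in>odom T. cinner (app T x) y = cinner x z" ..
    have "(THE z. \<forall>x\<in>odom T. cinner (app T x) y = cinner x z) = z"
    proof (rule the_equality)
      fix z' assume "\<forall>x\<in>odom T. cinner (app T x) y = cinner x z'"
      then have "inner x (z' - z) = 0" if "x \<in> odom T" for x
        using that z unfolding inner_eq_Re_cinner cinner_diff_right by simp
      then show "z' = z"
        using dense_inner_zero_imp_zero[OF dense, of "z' - z"] by simp
    qed (rule z)
    then have "app T y = z"
      using app[OF y] unfolding adjoint_operator_def by simp
    then show ?thesis using z x by simp
  qed
  then show ?thesis
    using lin unfolding symmetric_operator_def by blast
qed

lemma app_commutator: "app (commutator S T) x = app S (app T x) - app T (app S x)"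
  by (simp add: commutator_def op_diff_def op_comp_def)

lemma odom_commutator:
  "odom (commutator S T)
     = {x. x \<in> odom S \<and> x \<in> odom T \<and> app T x \<in> odom S \<and> app S x \<in> odom T}"
  by (auto simp: commutator_def op_diff_def op_comp_def)

lemma symmetric_operatorD:
  assumes "symmetric_operator T"
  shows "x \<in> odom T \<Longrightarrow> y \<in> odom T \<Longrightarrow> cinner (app T x) y = cinner x (app T y)"
    and "x \<in> odom T \<Longrightarrow> app T (c *\<^sub>R x) = c *\<^sub>R app T x"
  using assms unfolding symmetric_operator_def linear_operator_def scaleR_eq_scaleC by auto

context
  fixes A B :: "'a::complex_inner operator" and v :: 'a and l :: real
  assumes A: "symmetric_operator A" and B: "symmetric_operator B"
    and eigen: "app A v = l *\<^sub>R v"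
begin

lemma commutator_eigenvector:
  assumes "v \<in> odom B"
  shows "app (commutator A B) v = app A (app B v) - l *\<^sub>R app B v"
  by (simp add: app_commutator eigen symmetric_operatorD[OF B] assms)

text \<open>Moving \<open>A\<close> onto \<open>w\<close> shows that the coefficients of
  \<open>[A,B] v\<close> in the eigenbasis are those of \<open>B v\<close> times spectral
  gaps.\<close>

lemma cinner_commutator_eigenvectors:
  assumes "v \<in> odom (commutator A B)" and "w \<in> odom A" and "app A w = l' *\<^sub>R w"
  shows "cinner (app (commutator A B) v) w = of_real (l' - l) * cinner (app B v) w"
proof -
  have "v \<in> odom B" "app B v \<in> odom A"
    using assms(1) by (auto simp: odom_commutator)
  then show ?thesis
    using assms symmetric_operatorD(1)[OF A, of "app B v" w]
    by (simp add: commutator_eigenvector cinner_diff_left cinner_scaleR_left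
        cinner_scaleR_right algebra_simps)
qed

text \<open>Moving \<open>A\<close> and \<open>B\<close> across the inner product turns the second
  half of the outer commutator into the negative of the first; subtracting gives the factor
  2.\<close>

lemma inner_double_commutator_eigenvector:
  assumes "v \<in> odom (commutator B (commutator A B))"
  shows "Re (cinner (app (commutator B (commutator A B)) v) v)
           = 2 * inner (app (commutator A B) v) (app B v)"
proof -
  let ?b = "app B v"
  have d: "v \<in> odom A" "v \<in> odom B" "?b \<in> odom A" "?b \<in> odom B" "app B ?b \<in> odom A"
    "app A ?b \<in> odom B" "app (commutator A B) v \<in> odom B"
    using assms by (auto simp: odom_commutator)
  have 1: "cinner (app B (app (commutator A B) v)) v = cinner (app (commutator A B) v) ?b"
    by (rule symmetric_operatorD(1)[OF B d(7) d(2)])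
  have "cinner (app A (app B ?b)) v = of_real l * cinner ?b ?b"
    using symmetric_operatorD(1)[OF A d(5) d(1)] symmetric_operatorD(1)[OF B d(4) d(2)]
    by (simp add: eigen cinner_scaleR_right)
  moreover have "cinner (app B (app A ?b)) v = cinner (app A ?b) ?b"
    by (rule symmetric_operatorD(1)[OF B d(6) d(2)])
  ultimately have 2: "cinner (app (commutator A B) ?b) v = - cinner (app (commutator A B) v) ?b"
    unfolding commutator_eigenvector[OF d(2)] app_commutator[of A B ?b] cinner_diff_left
      cinner_scaleR_left by simp
  show ?thesis
    unfolding app_commutator[of B] cinner_diff_left 1 2 inner_eq_Re_cinner by simp
qed

text \<open>Formally \<open>[A,B]\<close> is skew-symmetric. To respect domains, \<open>A\<close>
  and \<open>B\<close> are moved one at a time, each move justified by a membership contained in the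
  domain of the square.\<close>

lemma cinner_commutator_square_eigenvector:
  assumes "v \<in> odom (op_comp (commutator A B) (commutator A B))"
  shows "cinner (app (op_comp (commutator A B) (commutator A B)) v) v
           = - cinner (app (commutator A B) v) (app (commutator A B) v)"
proof -
  let ?c = "app (commutator A B) v" and ?b = "app B v"
  have d: "v \<in> odom A" "v \<in> odom B" "?b \<in> odom A" "?c \<in> odom A" "?c \<in> odom B"
    "app B ?c \<in> odom A" "app A ?c \<in> odom B"
    using assms by (auto simp: op_comp_def odom_commutator)
  have 1: "cinner (app A (app B ?c)) v = of_real l * cinner ?c ?b"
    using symmetric_operatorD(1)[OF A d(6) d(1)] symmetric_operatorD(1)[OF B d(5) d(2)]
    by (simp add: eigen cinner_scaleR_right)
  have 2: "cinner (app B (app A ?c)) v = cinner ?c (app A ?b)"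
    using symmetric_operatorD(1)[OF B d(7) d(2)] symmetric_operatorD(1)[OF A d(4) d(3)] by simp
  \<comment> \<open>Only the second argument is expanded, so that the first stays \<open>?c\<close>
    as in the two preceding facts.\<close>
  have "cinner ?c ?c = cinner ?c (app A ?b) - of_real l * cinner ?c ?b"
    by (subst (2) commutator_eigenvector[OF d(2)])
      (simp add: cinner_diff_right cinner_scaleR_right)
  then show ?thesis
    unfolding op_comp_def by (simp add: app_commutator[of A B ?c] cinner_diff_left 1 2)
qed

end

section \<open>Yang's inequality\<close>

text \<open>For indices up to m both sides agree after symmetrisation in i and j; beyond m the
  factor z - lam i is dominated by lam j - lam i.\<close>

lemma weighted_gap_sum_le:
  fixes lam :: "nat \<Rightarrow> real" and w :: "nat \<Rightarrow> nat \<Rightarrow> real"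
  assumes mono: "mono_on {1..} lam" and sym: "\<And>i j. 1 \<le> i \<Longrightarrow> 1 \<le> j \<Longrightarrow> w i j = w j i"
    and nonneg: "\<And>i j. 0 \<le> w i j"
    and "1 \<le> m" "m \<le> n" and z: "lam m \<le> z" "z \<le> lam (Suc m)"
  shows "(\<Sum>i=1..m. (z - lam i)\<^sup>2 * (\<Sum>j=1..n. (lam j - lam i) * w i j))
       \<le> (\<Sum>i=1..m. (z - lam i) * (\<Sum>j=1..n. (lam j - lam i)\<^sup>2 * w i j))"
proof -
  define g where
    "g i j = ((z - lam i) * (lam j - lam i)\<^sup>2 - (z - lam i)\<^sup>2 * (lam j - lam i)) * w i j" for i j
  have split: "(\<Sum>j=1..n. g i j) = (\<Sum>j=1..m. g i j) + (\<Sum>j=Suc m..n. g i j)" for i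
    using sum.ub_add_nat[of 1 m "g i" "n - m"] \<open>1 \<le> m\<close> \<open>m \<le> n\<close> by simp
  have swap: "(\<Sum>i=1..m. \<Sum>j=1..m. g i j) = (\<Sum>i=1..m. \<Sum>j=1..m. g j i)"
    by (rule sum.swap)
  have "g i j + g j i = 0" if "1 \<le> i" "1 \<le> j" for i j
    unfolding g_def sym[OF that] by (simp add: algebra_simps power2_eq_square)
  then have "(\<Sum>i=1..m. \<Sum>j=1..m. g i j + g j i) = 0"
    by (intro sum.neutral ballI) auto
  then have "(\<Sum>i=1..m. \<Sum>j=1..m. g i j) = 0"
    using swap by (simp add: sum.distrib)
  moreover have "0 \<le> (\<Sum>i=1..m. \<Sum>j=Suc m..n. g i j)"
  proof (intro sum_nonneg)
    fix i j assume ij: "i \<in> {1..m}" "j \<in> {Suc m..n}"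
    have "lam i \<le> lam m" "lam (Suc m) \<le> lam j"
      using ij by (auto intro!: mono_onD[OF mono])
    then have "0 \<le> ((z - lam i) * (lam j - lam i)) * (lam j - z) * w i j"
      using z nonneg by (intro mult_nonneg_nonneg) auto
    also have "\<dots> = g i j"
      unfolding g_def by (simp add: algebra_simps power2_eq_square)
    finally show "0 \<le> g i j" .
  qed
  ultimately have "0 \<le> (\<Sum>i=1..m. \<Sum>j=1..n. g i j)"
    unfolding split sum.distrib by simp
  also have "\<dots> = (\<Sum>i=1..m. (z - lam i) * (\<Sum>j=1..n. (lam j - lam i)\<^sup>2 * w i j))
      - (\<Sum>i=1..m. (z - lam i)\<^sup>2 * (\<Sum>j=1..n. (lam j - lam i) * w i j))"
    unfolding g_def sum_distrib_left sum_subtractf[symmetric]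
    by (intro sum.cong refl) (simp add: algebra_simps)
  finally show ?thesis by simp
qed

text \<open>\<open>weighted_gap_sum_le\<close> compares \<open>H\<close> with \<open>G\<close> for
  each \<open>k\<close>; the double commutator bounds \<open>G\<close> below for each
  \<open>k\<close>, while the squared commutators bound only the sum of \<open>H\<close> over
  \<open>k\<close> from above.\<close>

lemma yang_inequality:
  fixes A :: "'a::chilbert_space operator"
  assumes sa: "selfadjoint_operator A"
    and mono: "mono_on {1..} lam"
    and basis: "orthonormal_basis {1..} u"
    and eigen: "\<forall>i\<ge>1. u i \<in> odom A \<and> app A (u i) = lam i *\<^sub>R u i"
    and "N \<ge> 1" and "\<gamma> > 0"
    and B_sym: "\<forall>k\<in>{1..N}. symmetric_operator (B k)"
    and lower: "\<forall>k\<in>{1..N}. op_bounded_below_by \<gamma> (commutator (B k) (commutator A (B k)))"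
    and upper: "op_le
          (op_scale (-1) (op_sum (\<lambda>k. op_comp (commutator A (B k)) (commutator A (B k))) {1..N}))
          (op_scale \<beta> A)"
    and dom_lower: "\<forall>i\<ge>1. \<forall>k\<in>{1..N}. u i \<in> odom (commutator (B k) (commutator A (B k)))"
    and dom_upper: "\<forall>i\<ge>1. u i \<in>
          odom (op_sum (\<lambda>k. op_comp (commutator A (B k)) (commutator A (B k))) {1..N})"
    and "1 \<le> m" and z: "lam m \<le> z" "z \<le> lam (Suc m)"
  shows "(\<Sum>i=1..m. (z - lam i)\<^sup>2)
           \<le> 2 * (\<beta> / (\<gamma> * real N)) * (\<Sum>i=1..m. (z - lam i) * lam i)"
proof -
  have A: "symmetric_operator A"
    by (rule selfadjoint_imp_symmetric_operator[OF sa])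
  define C where "C k i = app (commutator A (B k)) (u i)" for k i
  define W where "W k i j = (Re (cinner (app (B k) (u i)) (u j)))\<^sup>2
      + (Im (cinner (app (B k) (u i)) (u j)))\<^sup>2" for k i j
  define G where "G k i = inner (C k i) (app (B k) (u i))" for k i
  define H where "H k i = inner (C k i) (C k i)" for k i
  have unit: "cinner (u i) (u i) = 1" if "1 \<le> i" for i
    using basis that unfolding orthonormal_basis_def by auto
  have domC: "u i \<in> odom (commutator A (B k))" if "1 \<le> i" "k \<in> {1..N}" for i k
    using dom_lower that by (auto simp: odom_commutator)
  have coeff: "cinner (C k i) (u j) = of_real (lam j - lam i) * cinner (app (B k) (u i)) (u j)"
    if "1 \<le> i" "1 \<le> j" "k \<in> {1..N}" for i j k
    unfolding C_def using that eigen B_sym domC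
    by (intro cinner_commutator_eigenvectors[OF A]) auto
  have limG: "(\<lambda>n. \<Sum>j=1..n. (lam j - lam i) * W k i j) \<longlonglongrightarrow> G k i"
    if "1 \<le> i" "k \<in> {1..N}" for i k
  proof -
    have "(\<Sum>j=1..n. Re (cinner (C k i) (u j) * cnj (cinner (app (B k) (u i)) (u j))))
        = (\<Sum>j=1..n. (lam j - lam i) * W k i j)" for n
      using that by (intro sum.cong)
        (simp_all add: coeff W_def power2_eq_square algebra_simps)
    then show ?thesis
      using parseval_tendsto[OF basis, of "C k i" "app (B k) (u i)"] by (simp add: G_def)
  qed
  have limH: "(\<lambda>n. \<Sum>j=1..n. (lam j - lam i)\<^sup>2 * W k i j) \<longlonglongrightarrow> H k i"
    if "1 \<le> i" "k \<in> {1..N}" for i k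
  proof -
    have "(\<Sum>j=1..n. Re (cinner (C k i) (u j) * cnj (cinner (C k i) (u j))))
        = (\<Sum>j=1..n. (lam j - lam i)\<^sup>2 * W k i j)" for n
      using that by (intro sum.cong)
        (simp_all add: coeff W_def power2_eq_square algebra_simps)
    then show ?thesis
      using parseval_tendsto[OF basis, of "C k i" "C k i"] by (simp add: H_def)
  qed
  \<comment> \<open>The comparison holds for every truncation \<open>n\<close> of the eigenbasis
    from \<open>m\<close> on, and survives the limit because the sum over \<open>i\<close> is
    finite.\<close>
  have GH: "(\<Sum>i=1..m. (z - lam i)\<^sup>2 * G k i) \<le> (\<Sum>i=1..m. (z - lam i) * H k i)"
    if k: "k \<in> {1..N}" for k
  proof (rule LIMSEQ_le)
    show "(\<lambda>n. \<Sum>i=1..m. (z - lam i)\<^sup>2 * (\<Sum>j=1..n. (lam j - lam i) * W k i j))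
        \<longlonglongrightarrow> (\<Sum>i=1..m. (z - lam i)\<^sup>2 * G k i)"
      using k by (intro tendsto_sum tendsto_mult tendsto_const limG) auto
    show "(\<lambda>n. \<Sum>i=1..m. (z - lam i) * (\<Sum>j=1..n. (lam j - lam i)\<^sup>2 * W k i j))
        \<longlonglongrightarrow> (\<Sum>i=1..m. (z - lam i) * H k i)"
      using k by (intro tendsto_sum tendsto_mult tendsto_const limH) auto
    have sym: "W k i j = W k j i" if "1 \<le> i" "1 \<le> j" for i j
    proof -
      have "u i \<in> odom (B k)" "u j \<in> odom (B k)"
        using domC that k by (auto simp: odom_commutator)
      then have "cinner (app (B k) (u i)) (u j) = cnj (cinner (app (B k) (u j)) (u i))"
        using symmetric_operatorD(1) B_sym k cinner_commute by metis
      then show ?thesis by (simp add: W_def)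
    qed
    show "\<exists>n0. \<forall>n\<ge>n0. (\<Sum>i=1..m. (z - lam i)\<^sup>2 * (\<Sum>j=1..n. (lam j - lam i) * W k i j))
        \<le> (\<Sum>i=1..m. (z - lam i) * (\<Sum>j=1..n. (lam j - lam i)\<^sup>2 * W k i j))"
      by (intro exI[of _ m] allI impI weighted_gap_sum_le[OF mono sym _ \<open>1 \<le> m\<close> _ z])
        (simp_all add: W_def)
  qed
  have G: "\<gamma> / 2 \<le> G k i" if "1 \<le> i" "k \<in> {1..N}" for i k
  proof -
    have dom: "u i \<in> odom (commutator (B k) (commutator A (B k)))"
      using dom_lower that by blast
    have "\<gamma> * Re (cinner (u i) (u i))
        \<le> Re (cinner (app (commutator (B k) (commutator A (B k))) (u i)) (u i))"
      using lower dom that unfolding op_bounded_below_by_def by blast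
    also have "\<dots> = 2 * G k i"
      unfolding G_def C_def
      by (rule inner_double_commutator_eigenvector[OF A _ _ dom]) (use B_sym eigen that in auto)
    finally show ?thesis using unit that by simp
  qed
  have H: "(\<Sum>k=1..N. H k i) \<le> \<beta> * lam i" if i: "1 \<le> i" for i
  proof -
    let ?CC = "\<lambda>k. op_comp (commutator A (B k)) (commutator A (B k))"
    have dom: "u i \<in> odom (op_sum ?CC {1..N})"
      using dom_upper i by blast
    have CC: "cinner (app (?CC k) (u i)) (u i) = - cinner (C k i) (C k i)" if "k \<in> {1..N}" for k
      unfolding C_def
      by (rule cinner_commutator_square_eigenvector[OF A])
        (use dom B_sym eigen i that in \<open>auto simp: op_sum_def\<close>)
    have "0 \<le> Re (cinner (app (op_diff (op_scale \<beta> A) (op_scale (-1) (op_sum ?CC {1..N})))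
        (u i)) (u i))"
      using upper dom unfolding op_le_def by (simp add: op_scale_def)
    also have "\<dots> = Re (cinner (\<beta> *\<^sub>R lam i *\<^sub>R u i) (u i))
        + (\<Sum>k=1..N. Re (cinner (app (?CC k) (u i)) (u i)))"
      using eigen i
      by (simp add: op_diff_def op_scale_def op_sum_def cinner_add_left cinner_sum_left)
    also have "\<dots> = \<beta> * lam i - (\<Sum>k=1..N. H k i)"
      using unit[OF i] by (simp add: CC H_def inner_eq_Re_cinner cinner_scaleR_left sum_negf)
    finally show ?thesis by simp
  qed
  have gap: "0 \<le> z - lam i" if "i \<in> {1..m}" for i
    using mono_onD[OF mono, of i m] that z by auto
  \<comment> \<open>Adding the lower bounds \<gamma>/2 over \<open>k\<close> produces the factor
    \<open>N\<close>; this is where the constant 2\<beta>/(\<gamma>N) comes from.\<close>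
  have "real N * (\<gamma> / 2) * (\<Sum>i=1..m. (z - lam i)\<^sup>2)
      = (\<Sum>k=1..N. \<Sum>i=1..m. (z - lam i)\<^sup>2 * (\<gamma> / 2))"
    by (simp add: sum_distrib_left sum_distrib_right mult_ac)
  also have "\<dots> \<le> (\<Sum>k=1..N. \<Sum>i=1..m. (z - lam i)\<^sup>2 * G k i)"
    using G by (intro sum_mono mult_left_mono) auto
  also have "\<dots> \<le> (\<Sum>k=1..N. \<Sum>i=1..m. (z - lam i) * H k i)"
    by (rule sum_mono) (rule GH)
  also have "\<dots> = (\<Sum>i=1..m. (z - lam i) * (\<Sum>k=1..N. H k i))"
    by (subst sum.swap) (simp add: sum_distrib_left)
  also have "\<dots> \<le> (\<Sum>i=1..m. (z - lam i) * (\<beta> * lam i))"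
    using H gap by (intro sum_mono mult_left_mono) auto
  also have "\<dots> = \<beta> * (\<Sum>i=1..m. (z - lam i) * lam i)"
    by (simp add: sum_distrib_left mult_ac)
  finally have "real N * (\<gamma> / 2) * (\<Sum>i=1..m. (z - lam i)\<^sup>2)
      \<le> \<beta> * (\<Sum>i=1..m. (z - lam i) * lam i)" .
  then show ?thesis
    using \<open>N \<ge> 1\<close> \<open>\<gamma> > 0\<close> by (simp add: field_simps)
qed


section \<open>From the quadratic to the higher inequalities\<close>

lemma powr_add_one:
  fixes t :: real
  shows "0 < t \<Longrightarrow> t powr (q + 1) = t powr q * t"
  by (simp add: powr_add)

lemma powr_add_two:
  fixes t :: real
  shows "0 < t \<Longrightarrow> t powr (q + 2) = t powr q * t\<^sup>2"
  by (simp add: powr_add)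

text \<open>The left side is the antiderivative used below, evaluated at \<open>a\<close>, with
  \<open>y\<close> standing for \<open>a powr (p - 2)\<close>; what remains is an identity of
  rational functions.\<close>

lemma truncated_power_coefficients:
  fixes p :: real
  assumes "2 < p"
  shows "(a\<^sup>2 - 2 * c * a * l) * (y / (p - 2)) + (2 * c * l - 2 * a) * (y * a / (p - 1)) + y * a\<^sup>2 / p
           = 2 / (p * (p - 1) * (p - 2)) * (y * a\<^sup>2 - p * c * (y * a * l))"
proof -
  \<comment> \<open>In terms of \<open>r\<close> all three denominators are visibly
    positive.\<close>
  define r where "r = p - 2"
  have p: "p - 1 = r + 1" "p = r + 2" "p - 2 = r"
    by (auto simp: r_def)
  have "0 < r" "0 < r + 1" "0 < r + 2"
    using assms by (auto simp: p)
  then have "(a\<^sup>2 - 2 * c * a * l) * (y / r) + (2 * c * l - 2 * a) * (y * a / (r + 1)) + y * a\<^sup>2 / (r + 2)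
      = 2 / ((r + 2) * (r + 1) * r) * (y * a\<^sup>2 - (r + 2) * c * (y * a * l))"
    by (simp add: divide_simps less_imp_neq[symmetric]) (simp add: algebra_simps power2_eq_square)
  \<comment> \<open>The bare \<open>p\<close> is rewritten last, since otherwise it would be
    replaced inside \<open>p - 1\<close> and \<open>p - 2\<close>.\<close>
  then show ?thesis
    unfolding p(1) p(3) unfolding p(2) .
qed

text \<open>Two Beta integrals, with values B(p-2,3) and B(p-2,2). The endpoint \<open>T\<close> is
  independent of \<open>a\<close> so that all indices can later share one interval; past
  \<open>a\<close> the integrand vanishes.\<close>

lemma has_integral_truncated_power:
  fixes a c l p T :: real
  assumes "2 < p" and "a \<le> T" and "0 \<le> T"
  shows "((\<lambda>t. t powr (p - 3) * (if t \<le> a then (a - t)\<^sup>2 - 2 * c * (a - t) * l else 0))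
           has_integral (if 0 \<le> a then 2 / (p * (p - 1) * (p - 2))
             * (a powr p - p * c * (a powr (p - 1) * l)) else 0)) {0..T}"
proof (cases "0 \<le> a")
  case False
  have "((\<lambda>t. 0::real) has_integral (if 0 \<le> a then 2 / (p * (p - 1) * (p - 2))
      * (a powr p - p * c * (a powr (p - 1) * l)) else 0)) {0..T}"
    using False by simp
  then show ?thesis
    by (rule has_integral_eq[rotated]) (use False in auto)
next
  case True
  \<comment> \<open>The quadratic in \<open>a - t\<close> is expanded in powers of \<open>t\<close>
    and integrated term by term against \<open>t powr (p - 3)\<close>.\<close>
  define F where "F t = (a\<^sup>2 - 2 * c * a * l) * (t powr (p - 2) / (p - 2))
      + (2 * c * l - 2 * a) * (t powr (p - 1) / (p - 1)) + t powr p / p" for t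
  have "((\<lambda>t. t powr (p - 3) * ((a - t)\<^sup>2 - 2 * c * (a - t) * l)) has_integral F a - F 0) {0..a}"
  \<comment> \<open>For p < 3 the weight is unbounded near 0, so differentiability is asked for only
    inside; \<open>F\<close> is still continuous at 0 because p - 2 > 0.\<close>
  proof (rule fundamental_theorem_of_calculus_interior[OF True])
    have powr: "continuous_on {0..a} (\<lambda>t. t powr q)" if "0 < q" for q :: real
      by (rule continuous_on_powr'[OF continuous_on_id continuous_on_const]) (use that in auto)
    show "continuous_on {0..a} F"
      unfolding F_def using \<open>2 < p\<close>
      by (intro continuous_on_add continuous_on_mult_left continuous_on_divide
          continuous_on_const ballI powr) auto
    fix t assume "t \<in> {0<..<a}"
    then have t: "0 < t" by simp
    have e: "t powr (p - 2) = t powr (p - 3) * t" "t powr (p - 1) = t powr (p - 3) * t\<^sup>2"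
      using powr_add_one[OF t, of "p - 3"] powr_add_two[OF t, of "p - 3"] by simp_all
    have "(F has_real_derivative (a\<^sup>2 - 2 * c * a * l) * t powr (p - 3)
      + (2 * c * l - 2 * a) * t powr (p - 2) + t powr (p - 1)) (at t)"
      unfolding F_def using t \<open>2 < p\<close>
      by (auto intro!: derivative_eq_intros)
    then show "(F has_vector_derivative t powr (p - 3) * ((a - t)\<^sup>2 - 2 * c * (a - t) * l)) (at t)"
      unfolding has_real_derivative_iff_has_vector_derivative[symmetric] e
      by (rule DERIV_cong) (simp add: algebra_simps power2_eq_square)
  qed
  then have left: "((\<lambda>t. t powr (p - 3) * (if t \<le> a then (a - t)\<^sup>2 - 2 * c * (a - t) * l else 0))
      has_integral F a - F 0) {0..a}"
    by (rule has_integral_eq[rotated]) simp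
  have "((\<lambda>t. 0::real) has_integral 0) {a..T}" by simp
  then have right: "((\<lambda>t. t powr (p - 3) * (if t \<le> a then (a - t)\<^sup>2 - 2 * c * (a - t) * l else 0))
      has_integral 0) {a..T}"
    by (rule has_integral_eq[rotated]) auto
  have "F a - F 0 = 2 / (p * (p - 1) * (p - 2)) * (a powr p - p * c * (a powr (p - 1) * l))"
  proof (cases "a = 0")
    case False
    then have "0 < a" using True by simp
    have e: "a powr (p - 1) = a powr (p - 2) * a" "a powr p = a powr (p - 2) * a\<^sup>2"
      using powr_add_one[OF \<open>0 < a\<close>, of "p - 2"] powr_add_two[OF \<open>0 < a\<close>, of "p - 2"]
      by simp_all
    show ?thesis
      using truncated_power_coefficients[OF \<open>2 < p\<close>, of a c l "a powr (p - 2)"]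
      unfolding F_def e by simp
  qed (simp add: F_def)
  then show ?thesis
    using has_integral_combine[OF True \<open>a \<le> T\<close> left right] True by simp
qed

text \<open>Collects what the operators contribute to the rest of the argument. Every index
  \<open>j\<close> is included, because truncation can cut the sum at any j \<le> m.\<close>

locale yang_sequence =
  fixes lam :: "nat \<Rightarrow> real" and c :: real
  assumes mono: "mono_on {1..} lam"
    and yang: "\<And>j z. 1 \<le> j \<Longrightarrow> lam j \<le> z \<Longrightarrow> z \<le> lam (Suc j) \<Longrightarrow>
      (\<Sum>i=1..j. (z - lam i)\<^sup>2) \<le> 2 * c * (\<Sum>i=1..j. (z - lam i) * lam i)"
begin

text \<open>Truncation keeps the indices up to the last \<open>j\<close> with lam j \<le> z. For j <
  m, \<open>z\<close> lies below the next eigenvalue and \<open>yang\<close> applies; for j = m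
  nothing bounds \<open>z\<close> from above, and \<open>top\<close> takes over.\<close>

lemma truncated_sum_nonpos:
  assumes "1 \<le> m"
    and top: "lam m \<le> z \<Longrightarrow> (\<Sum>i=1..m. (z - lam i)\<^sup>2) \<le> 2 * c * (\<Sum>i=1..m. (z - lam i) * lam i)"
  shows "(\<Sum>i=1..m. if lam i \<le> z then (z - lam i)\<^sup>2 - 2 * c * (z - lam i) * lam i else 0) \<le> 0"
    (is "sum ?f _ \<le> 0")
proof (cases "lam 1 \<le> z")
  case False
  have "?f i = 0" if "i \<in> {1..m}" for i
    using mono_onD[OF mono, of 1 i] that False by auto
  then show ?thesis by simp
next
  case True
  have le: "lam i \<le> lam j" if "1 \<le> i" "i \<le> j" for i j
    using mono_onD[OF mono, of i j] that by auto
  \<comment> \<open>The largest index also handles ties: for j < m it forces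
    \<open>z < lam (Suc j)\<close> strictly.\<close>
  define j where "j = Max {i \<in> {1..m}. lam i \<le> z}"
  have "j \<in> {i \<in> {1..m}. lam i \<le> z}"
    unfolding j_def using True \<open>1 \<le> m\<close> by (intro Max_in) auto
  then have j: "1 \<le> j" "j \<le> m" "lam j \<le> z"
    by auto
  have above: "z < lam i" if "i \<in> {1..m}" "j < i" for i
    using Max_ge[of "{i \<in> {1..m}. lam i \<le> z}" i] that unfolding j_def[symmetric] by force
  have "?f i = 0" if "i \<in> {1..m} - {1..j}" for i
    using above[of i] that by auto
  then have "sum ?f {1..m} = sum ?f {1..j}"
    using j by (intro sum.mono_neutral_right) auto
  also have "\<dots> = (\<Sum>i=1..j. (z - lam i)\<^sup>2) - 2 * c * (\<Sum>i=1..j. (z - lam i) * lam i)"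
    using j le order_trans[OF le]
    by (auto simp: sum_distrib_left sum_subtractf mult.assoc intro!: sum.cong
        simp flip: sum_subtractf)
  also have "\<dots> \<le> 0"
  proof (cases "j = m")
    case True
    then show ?thesis using top j by simp
  next
    case False
    then show ?thesis using yang[of j z] above[of "Suc j"] j by auto
  qed
  finally show ?thesis .
qed

text \<open>Up to the factor 2 / (p (p - 1) (p - 2)), the p-th expression is the integral over t > 0 of
  t powr (p - 3) times the truncated quadratic expression at z - t.\<close>

lemma powr_sum_nonpos:
  assumes "1 \<le> m" and "2 \<le> p" and z: "lam m \<le> z"
    and quad: "\<And>y. lam m \<le> y \<Longrightarrow> y \<le> z \<Longrightarrow>
      (\<Sum>i=1..m. (y - lam i)\<^sup>2) \<le> 2 * c * (\<Sum>i=1..m. (y - lam i) * lam i)"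
  shows "(\<Sum>i=1..m. (z - lam i) powr p - p * c * ((z - lam i) powr (p - 1) * lam i)) \<le> 0"
    (is "?S \<le> 0")
proof -
  have gap: "0 \<le> z - lam i" "z - lam i \<le> z - lam 1" if "i \<in> {1..m}" for i
    using mono_onD[OF mono, of i m] mono_onD[OF mono, of 1 i] that z by auto
  show ?thesis
  proof (cases "p = 2")
    \<comment> \<open>At p = 2 the weight 1/t is not integrable at 0; the claim is then
      \<open>quad\<close> at \<open>z\<close> itself.\<close>
    case True
    have "(\<Sum>i=1..m. (z - lam i) powr p - p * c * ((z - lam i) powr (p - 1) * lam i))
        = (\<Sum>i=1..m. (z - lam i)\<^sup>2) - 2 * c * (\<Sum>i=1..m. (z - lam i) * lam i)"
      unfolding sum_distrib_left sum_subtractf[symmetric] True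
      using gap by (intro sum.cong) auto
    then show ?thesis using quad[OF z order_refl] by simp
  next
    case False
    then have "2 < p" using \<open>2 \<le> p\<close> by simp
    define I where "I = (\<Sum>i=1..m. 2 / (p * (p - 1) * (p - 2))
      * ((z - lam i) powr p - p * c * ((z - lam i) powr (p - 1) * lam i)))"
    let ?g = "\<lambda>t i. t powr (p - 3) * (if t \<le> z - lam i
        then (z - lam i - t)\<^sup>2 - 2 * c * (z - lam i - t) * lam i else 0)"
    \<comment> \<open>\<open>z - lam 1\<close> is the largest gap, so this interval contains every
      truncation point.\<close>
    have "((\<lambda>t. \<Sum>i=1..m. ?g t i) has_integral I) {0..z - lam 1}"
      unfolding I_def
    proof (rule has_integral_sum)
      fix i assume "i \<in> {1..m}"
      from gap[OF this] show "((\<lambda>t. ?g t i) has_integral 2 / (p * (p - 1) * (p - 2))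
          * ((z - lam i) powr p - p * c * ((z - lam i) powr (p - 1) * lam i))) {0..z - lam 1}"
        using has_integral_truncated_power[OF \<open>2 < p\<close>, of "z - lam i" "z - lam 1" c "lam i"] by simp
    qed simp
    then have "((\<lambda>t. - (\<Sum>i=1..m. ?g t i)) has_integral - I) {0..z - lam 1}"
      by (rule has_integral_neg)
    \<comment> \<open>This is the truncated sum at z - t \<le> z, where \<open>quad\<close> provides
      the hypothesis \<open>top\<close>.\<close>
    moreover have "0 \<le> - (\<Sum>i=1..m. ?g t i)" if "t \<in> {0..z - lam 1}" for t
    proof -
      have "(\<Sum>i=1..m. if t \<le> z - lam i
            then (z - lam i - t)\<^sup>2 - 2 * c * (z - lam i - t) * lam i else 0)
          = (\<Sum>i=1..m. if lam i \<le> z - t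
            then (z - t - lam i)\<^sup>2 - 2 * c * (z - t - lam i) * lam i else 0)"
        by (intro sum.cong refl if_cong) (auto simp: algebra_simps)
      also have "\<dots> \<le> 0"
        using that by (intro truncated_sum_nonpos[OF \<open>1 \<le> m\<close>] quad) auto
      finally have "(\<Sum>i=1..m. if t \<le> z - lam i
          then (z - lam i - t)\<^sup>2 - 2 * c * (z - lam i - t) * lam i else 0) \<le> 0" .
      then show ?thesis
        unfolding sum_distrib_left[symmetric] by (simp add: mult_nonneg_nonpos)
    qed
    ultimately have "0 \<le> - I"
      by (rule has_integral_nonneg)
    moreover have "I = 2 / (p * (p - 1) * (p - 2)) * ?S"
      unfolding I_def sum_distrib_left ..
    moreover have "0 < 2 / (p * (p - 1) * (p - 2))"
      using \<open>2 < p\<close> by simp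
    ultimately show ?thesis
      using mult_pos_pos[of "2 / (p * (p - 1) * (p - 2))" ?S] by fastforce
  qed
qed

end

section \<open>The functions \<open>f_tilde\<close> and their thresholds\<close>

lemma f_tilde_eq:
  "f_tilde lam m N \<beta> \<gamma> s \<sigma>
     = 1 / real m * (\<Sum>i=1..m. (\<sigma> - lam i) powr s
         - s * (\<beta> / (\<gamma> * real N)) * ((\<sigma> - lam i) powr (s - 1) * lam i))"
  unfolding f_tilde_def sum_subtractf sum_distrib_left[symmetric]
  by (simp add: algebra_simps)

lemma f_tilde_two:
  assumes "mono_on {1..} lam" and "1 \<le> m" and "lam m \<le> \<sigma>"
  shows "f_tilde lam m N \<beta> \<gamma> 2 \<sigma>
     = 1 / real m * ((\<Sum>i=1..m. (\<sigma> - lam i)\<^sup>2)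
         - 2 * (\<beta> / (\<gamma> * real N)) * (\<Sum>i=1..m. (\<sigma> - lam i) * lam i))"
proof -
  have "0 \<le> \<sigma> - lam i" if "i \<in> {1..m}" for i
    using mono_onD[OF assms(1), of i m] that assms by auto
  then show ?thesis
    unfolding f_tilde_eq sum_distrib_left[symmetric, where r = "2 * (\<beta> / (\<gamma> * real N))"]
      sum_subtractf
    by (intro arg_cong2[where f = times] arg_cong2[where f = minus] sum.cong refl)
      auto
qed

text \<open>Completing the square; the subtracted constant is the radicand in
  \<open>sigma_two\<close>, which is thereby the larger root.\<close>

lemma f_tilde_two_quadratic:
  fixes \<beta> \<gamma> :: real and N :: nat
  assumes "mono_on {1..} lam" and "1 \<le> m" and "lam m \<le> \<sigma>"
  defines "c \<equiv> \<beta> / (\<gamma> * real N)"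
  shows "f_tilde lam m N \<beta> \<gamma> 2 \<sigma>
     = (\<sigma> - (1 + c) * S_mean lam m 1)\<^sup>2
       - ((1 + c)\<^sup>2 * (S_mean lam m 1)\<^sup>2 - (1 + 2 * c) * S_mean lam m 2)"
proof -
  have "(\<Sum>i=1..m. (\<sigma> - lam i)\<^sup>2) = real m * (\<sigma>\<^sup>2 - 2 * \<sigma> * S_mean lam m 1 + S_mean lam m 2)"
    using \<open>1 \<le> m\<close>
    by (simp add: S_mean_def power2_diff sum.distrib sum_subtractf sum_distrib_left algebra_simps)
  moreover have "(\<Sum>i=1..m. (\<sigma> - lam i) * lam i)
      = real m * (\<sigma> * S_mean lam m 1 - S_mean lam m 2)"
    using \<open>1 \<le> m\<close>
    by (simp add: S_mean_def sum_subtractf sum_distrib_left algebra_simps power2_eq_square)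
  ultimately show ?thesis
    using \<open>1 \<le> m\<close>
    by (simp add: f_tilde_two[OF assms(1-3)] flip: c_def)
      (simp add: field_simps power2_eq_square)
qed

lemma yang_sequence_thresholds:
  fixes N m :: nat and \<beta> \<gamma> p :: real
  assumes "yang_sequence lam (\<beta> / (\<gamma> * real N))" and m: "m \<ge> 1" and p: "p \<ge> 2"
  shows "(\<forall>\<sigma>. lam m \<le> \<sigma> \<and> ereal \<sigma> \<le> sigma_tilde lam m N \<beta> \<gamma> 2
              \<longrightarrow> f_tilde lam m N \<beta> \<gamma> p \<sigma> \<le> 0) \<and>
         ereal (lam (Suc m)) \<le> sigma_tilde lam m N \<beta> \<gamma> 2 \<and>
         ereal (lam (Suc m)) \<le> sigma_tilde lam m N \<beta> \<gamma> p \<and>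
         sigma_tilde lam m N \<beta> \<gamma> 2 \<le> sigma_tilde lam m N \<beta> \<gamma> p \<and>
         sigma_tilde lam m N \<beta> \<gamma> 2 = ereal (sigma_two lam m N \<beta> \<gamma>)"
proof -
  define c where "c = \<beta> / (\<gamma> * real N)"
  interpret yang_sequence lam c
    using assms(1) unfolding c_def .
  define b where "b = (1 + c) * S_mean lam m 1"
  define D where "D = (1 + c)\<^sup>2 * (S_mean lam m 1)\<^sup>2 - (1 + 2 * c) * S_mean lam m 2"
  define s2 where "s2 = b + sqrt D"
  have s2: "sigma_two lam m N \<beta> \<gamma> = s2"
    by (simp add: s2_def sigma_two_def b_def D_def c_def)
  have lam_le: "lam m \<le> lam (Suc m)"
    using m by (intro mono_onD[OF mono]) auto
  have quad: "f_tilde lam m N \<beta> \<gamma> 2 \<sigma> = (\<sigma> - b)\<^sup>2 - D" if "lam m \<le> \<sigma>" for \<sigma>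
    using f_tilde_two_quadratic[OF mono m that] by (simp add: b_def D_def c_def)
  have f2: "f_tilde lam m N \<beta> \<gamma> 2 \<sigma> \<le> 0 \<longleftrightarrow>
      (\<Sum>i=1..m. (\<sigma> - lam i)\<^sup>2) \<le> 2 * c * (\<Sum>i=1..m. (\<sigma> - lam i) * lam i)" if "lam m \<le> \<sigma>" for \<sigma>
    using m unfolding f_tilde_two[OF mono m that] c_def[symmetric] by (simp add: divide_le_0_iff)
  have start: "(\<sigma> - b)\<^sup>2 \<le> D" if "lam m \<le> \<sigma>" "\<sigma> \<le> lam (Suc m)" for \<sigma>
    using yang[OF m that] f2[OF that(1)] quad[OF that(1)] by simp
  then have abs: "\<bar>\<sigma> - b\<bar> \<le> sqrt D" if "lam m \<le> \<sigma>" "\<sigma> \<le> lam (Suc m)" for \<sigma>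
    using that real_sqrt_le_mono[of "(\<sigma> - b)\<^sup>2" D] by simp
  \<comment> \<open>Yang's inequality at \<open>lam m\<close> makes the radicand nonnegative, so the
    roots are real.\<close>
  have "0 \<le> D"
    using start[OF order_refl lam_le] zero_le_power2 order_trans by blast
  have next_le: "lam (Suc m) \<le> s2"
    using abs[OF lam_le order_refl] unfolding s2_def by linarith
  \<comment> \<open>By \<open>abs\<close> at \<open>lam m\<close> the smaller root is at most
    \<open>lam m\<close>; to the right of \<open>lam m\<close> only the larger root
    \<open>s2\<close> decides the sign.\<close>
  have f2_iff: "f_tilde lam m N \<beta> \<gamma> 2 \<sigma> \<le> 0 \<longleftrightarrow> \<sigma> \<le> s2" if "lam m \<le> \<sigma>" for \<sigma>
  proof -
    have "f_tilde lam m N \<beta> \<gamma> 2 \<sigma> \<le> 0 \<longleftrightarrow> \<bar>\<sigma> - b\<bar> \<le> sqrt D"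
      unfolding quad[OF that] using real_sqrt_le_iff[of "(\<sigma> - b)\<^sup>2" D] by simp
    also have "\<dots> \<longleftrightarrow> \<sigma> \<le> s2"
      using abs[OF order_refl lam_le] that unfolding s2_def by linarith
    finally show ?thesis .
  qed
  \<comment> \<open>The admissible \<open>t\<close> form the interval from \<open>lam m\<close> to
    \<open>s2\<close>, nonempty because lam m \<le> lam (Suc m) \<le> s2.\<close>
  have sup2: "sigma_tilde lam m N \<beta> \<gamma> 2 = ereal s2"
    unfolding sigma_tilde_def using f2_iff lam_le next_le
    by (intro antisym SUP_least SUP_upper) (auto simp: f2_iff)
  have fp: "f_tilde lam m N \<beta> \<gamma> p \<sigma> \<le> 0" if "lam m \<le> \<sigma>" "\<sigma> \<le> s2" for \<sigma>
  proof -
    have "(\<Sum>i=1..m. (\<sigma> - lam i) powr p - p * c * ((\<sigma> - lam i) powr (p - 1) * lam i)) \<le> 0"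
    proof (rule powr_sum_nonpos[OF m p that(1)])
      fix y assume "lam m \<le> y" "y \<le> \<sigma>"
      then show "(\<Sum>i=1..m. (y - lam i)\<^sup>2) \<le> 2 * c * (\<Sum>i=1..m. (y - lam i) * lam i)"
        using f2[of y] f2_iff[of y] that by linarith
    qed
    then show ?thesis
      unfolding f_tilde_eq c_def[symmetric] by (simp add: mult_nonneg_nonpos divide_le_0_iff)
  qed
  \<comment> \<open>By \<open>fp\<close>, \<open>s2\<close> itself lies in the set whose supremum is
    the threshold for \<open>p\<close>.\<close>
  have supp: "ereal s2 \<le> sigma_tilde lam m N \<beta> \<gamma> p"
    unfolding sigma_tilde_def using fp lam_le next_le
    by (intro SUP_upper) auto
  show ?thesis
    using sup2 supp s2 fp next_le order_trans[OF _ supp, of "ereal (lam (Suc m))"] by auto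
qed

theorem theorem16:
  fixes A :: "'a::chilbert_space operator"
    and B :: "nat \<Rightarrow> 'a operator"
    and lam :: "nat \<Rightarrow> real"
    and u :: "nat \<Rightarrow> 'a"
    and N m :: nat
    and \<beta> \<gamma> p :: real
  assumes "selfadjoint_operator A"
    and "semibounded_below A"
    and "has_discrete_spectrum A"
    and lam_mono: "mono_on {1..} lam"
    and u_basis: "orthonormal_basis {1..} u"
    and u_eigen: "\<forall>i\<ge>1. u i \<in> odom A \<and> app A (u i) = lam i *\<^sub>R u i"
    and "N \<ge> 1"
    and B_sym: "\<forall>k\<in>{1..N}. symmetric_operator (B k)"
    and B_dom: "\<forall>k\<in>{1..N}. odom A \<union> app A ` odom A \<subseteq> odom (B k)"
    and B_inv: "\<forall>k\<in>{1..N}. app (B k) ` odom A \<subseteq> odom A"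
    and "\<beta> > 0" and "\<gamma> > 0"
    and lower: "\<forall>k\<in>{1..N}. op_bounded_below_by \<gamma> (commutator (B k) (commutator A (B k)))"
    and upper: "op_le
          (op_scale (-1) (op_sum (\<lambda>k. op_comp (commutator A (B k)) (commutator A (B k))) {1..N}))
          (op_scale \<beta> A)"
    and u_dom_lower: "\<forall>i\<ge>1. \<forall>k\<in>{1..N}. u i \<in> odom (commutator (B k) (commutator A (B k)))"
    and u_dom_upper: "\<forall>i\<ge>1. u i \<in>
          odom (op_sum (\<lambda>k. op_comp (commutator A (B k)) (commutator A (B k))) {1..N})"
    and "m \<ge> 1" and "p \<ge> 2"
  shows "(\<forall>\<sigma>. lam m \<le> \<sigma> \<and> ereal \<sigma> \<le> sigma_tilde lam m N \<beta> \<gamma> 2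
              \<longrightarrow> f_tilde lam m N \<beta> \<gamma> p \<sigma> \<le> 0) \<and>
         ereal (lam (Suc m)) \<le> sigma_tilde lam m N \<beta> \<gamma> 2 \<and>
         ereal (lam (Suc m)) \<le> sigma_tilde lam m N \<beta> \<gamma> p \<and>
         sigma_tilde lam m N \<beta> \<gamma> 2 \<le> sigma_tilde lam m N \<beta> \<gamma> p \<and>
         sigma_tilde lam m N \<beta> \<gamma> 2 = ereal (sigma_two lam m N \<beta> \<gamma>)"
proof (rule yang_sequence_thresholds)
  \<comment> \<open>Yang's inequality enters with its index left free, so it is available for all
    \<open>j\<close> and not only for the given \<open>m\<close>.\<close>
  show "yang_sequence lam (\<beta> / (\<gamma> * real N))"
    by (rule yang_sequence.intro[OF lam_mono yang_inequality[OF \<open>selfadjoint_operator A\<close>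
          lam_mono u_basis u_eigen \<open>N \<ge> 1\<close> \<open>\<gamma> > 0\<close> B_sym lower upper u_dom_lower u_dom_upper]])
qed (use \<open>m \<ge> 1\<close> \<open>p \<ge> 2\<close> in auto)

end
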